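(* Let $\langle \mathcal W_0, \mathcal W_1\rangle$ denote the subalgebra of $\mathcal U^+_q$ generated by $\mathcal W_0, \mathcal W_1$. The following (i), (ii) hold: (i) there exists an algebra isomorphism $U^+_q \to \langle \mathcal W_0, \mathcal W_1\rangle$ that sends $W_0 \mapsto \mathcal W_0$ and $W_1 \mapsto \mathcal W_1$; (ii) the inverse of this isomorphism is the restriction of $\gamma$ to $\langle \mathcal W_0, \mathcal W_1\rangle$.
   Context: Let $\mathbb F$ be a field and fix a nonzero $q\in\mathbb F$ that is not a root of unity. $\mathbb N=\{0,1,2,\ldots\}$. All algebras are associative, over $\mathbb F$, with multiplicative identity; a subalgebra has the same multiplicative identity as the parent algebra. For elements $X,Y$ of an algebra, $[X,Y]=XY-YX$, and $[X,Y]_q=qXY-q^{-1}YX$ (so $[X,Y]_{q^{-1}}=q^{-1}XY-qYX$). The algebra $U^+_q$ is defined by generators $A,B$ and the relations $[A,[A,[A,B]_q]_{q^{-1}}]=0$, $[B,[B,[B,A]_q]_{q^{-1}}]=0$. Its alternating elements $W_{-k}, W_{k+1}, G_{k+1}, \tilde G_{k+1}$ ($k\in\mathbb N$) are the elements determined recursively, in the order $W_0,W_1,G_1,\tilde G_1,W_{-1},W_2,G_2,\tilde G_2,W_{-2},W_3,\ldots$, by $W_0=A$, $W_1=B$, and for $n\ge 1$ $$G_n = \frac{q\sum_{k=0}^{n-1} W_{-k} W_{n-k} q^{n-1-2k}-\sum_{k=1}^{n-1} G_k \tilde G_{n-k} q^{n-2k}}{q^n+q^{-n}}+\frac{W_n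 W_0-W_0 W_n}{(1+q^{-2n})(1-q^{-2})},$$ $$\tilde G_n = G_n + \frac{W_0 W_n-W_n W_0}{1-q^{-2}},\quad W_{-n} = \frac{q W_0 G_n - q^{-1} G_n W_0}{q-q^{-1}},\quad W_{n+1} = \frac{q G_n W_1 - q^{-1} W_1 G_n}{q-q^{-1}}.$$ Also $G_0=\tilde G_0=1$. The algebra $\mathcal U^+_q$ is defined by generators (called alternating generators) $\mathcal W_{-k}, \mathcal W_{k+1}, \mathcal G_{k+1}, \mathcal{\tilde G}_{k+1}$ ($k\in\mathbb N$) and the following relations for all $k,\ell\in\mathbb N$: $[\mathcal W_0,\mathcal W_{k+1}]=[\mathcal W_{-k},\mathcal W_1]=(1-q^{-2})(\mathcal{\tilde G}_{k+1}-\mathcal G_{k+1})$; $[\mathcal W_0,\mathcal G_{k+1}]_q=[\mathcal{\tilde G}_{k+1},\mathcal W_0]_q=(q-q^{-1})\mathcal W_{-k-1}$; $[\mathcal G_{k+1},\mathcal W_1]_q=[\mathcal W_1,\mathcal{\tilde G}_{k+1}]_q=(q-q^{-1})\mathcal W_{k+2}$; $[\mathcal W_{-k},\mathcal W_{-\ell}]=0$; $[\mathcal W_{k+1},\mathcal W_{\ell+1}]=0$; $[\mathcal W_{-k},\mathcal W_{\ell+1}]+[\mathcal W_{k+1},\mathcal W_{-\ell}]=0$; $[\mathcal W_{-k},\mathcal G_{\ell+1}]+[\mathcal G_{k+1},\mathcal W_{-\ell}]=0$; $[\mathcal W_{-k},\mathcal{\tilde G}_{\ell+1}]+[\mathcal{\tilde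 G}_{k+1},\mathcal W_{-\ell}]=0$; $[\mathcal W_{k+1},\mathcal G_{\ell+1}]+[\mathcal G_{k+1},\mathcal W_{\ell+1}]=0$; $[\mathcal W_{k+1},\mathcal{\tilde G}_{\ell+1}]+[\mathcal{\tilde G}_{k+1},\mathcal W_{\ell+1}]=0$; $[\mathcal G_{k+1},\mathcal G_{\ell+1}]=0$; $[\mathcal{\tilde G}_{k+1},\mathcal{\tilde G}_{\ell+1}]=0$; $[\mathcal{\tilde G}_{k+1},\mathcal G_{\ell+1}]+[\mathcal G_{k+1},\mathcal{\tilde G}_{\ell+1}]=0$. Also $\mathcal G_0=\mathcal{\tilde G}_0=1$. $\gamma:\mathcal U^+_q\to U^+_q$ denotes the algebra homomorphism that sends $\mathcal W_{-n}\mapsto W_{-n}$, $\mathcal W_{n+1}\mapsto W_{n+1}$, $\mathcal G_n\mapsto G_n$, $\mathcal{\tilde G}_n\mapsto\tilde G_n$ for $n\in\mathbb N$. *)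

theory Defs
  imports "HOL-Algebra.QuotRing" "HOL-Algebra.Subrings" "HOL-Algebra.Module" "HOL-Library.Poly_Mapping"
begin

text \<open>
  The ground field is a type of class \<^class>\<open>field\<close>. An algebra over it is a
  \<^type>\<open>module_scheme\<close> record of HOL-Algebra: a ring together with a scalar multiplication.
  (The locale \<open>algebra\<close> of HOL-Algebra is confined to commutative algebras.)
\<close>

section \<open>Homomorphisms and subalgebras\<close>

definition alg_hom :: "('f, 'a) module \<Rightarrow> ('f, 'b) module \<Rightarrow> ('a \<Rightarrow> 'b) set" where
  "alg_hom M N =
     {h \<in> ring_hom M N. \<forall>c. \<forall>x \<in> carrier M. h (c \<odot>\<^bsub>M\<^esub> x) = c \<odot>\<^bsub>N\<^esub> h x}"

definition alg_iso :: "('f, 'a) module \<Rightarrow> ('f, 'b) module \<Rightarrow> ('a \<Rightarrow> 'b) set" where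
  "alg_iso M N = {h \<in> alg_hom M N. bij_betw h (carrier M) (carrier N)}"

definition is_subalgebra :: "'a set \<Rightarrow> ('f, 'a) module \<Rightarrow> bool" where
  "is_subalgebra S M \<longleftrightarrow> subring S M \<and> (\<forall>c. \<forall>x \<in> S. c \<odot>\<^bsub>M\<^esub> x \<in> S)"

definition generated_subalgebra :: "('f, 'a) module \<Rightarrow> 'a set \<Rightarrow> ('f, 'a) module" where
  "generated_subalgebra M A = M\<lparr>carrier := \<Inter>{S. is_subalgebra S M \<and> A \<subseteq> S}\<rparr>"


section \<open>Free algebras and presentations\<close>

text \<open>
  The monoid operation of the free monoid is written additively, because
  \<^theory>\<open>HOL-Library.Poly_Mapping\<close> turns an additive (not necessarily commutative) monoid of
  exponents into a convolution algebra.
\<close>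

datatype 'g free_monoid = FM "'g list"

instantiation free_monoid :: (type) monoid_add
begin

fun plus_free_monoid :: "'a free_monoid \<Rightarrow> 'a free_monoid \<Rightarrow> 'a free_monoid" where
  "FM u + FM v = FM (u @ v)"

definition zero_free_monoid :: "'a free_monoid" where
  "0 = FM []"

instance
proof
  fix a b c :: "'a free_monoid"
  show "a + b + c = a + (b + c)" by (cases a; cases b; cases c) simp
  show "0 + a = a" by (cases a) (simp add: zero_free_monoid_def)
  show "a + 0 = a" by (cases a) (simp add: zero_free_monoid_def)
qed

end

type_synonym ('f, 'g) free_alg = "'g free_monoid \<Rightarrow>\<^sub>0 'f"

definition gen :: "'g \<Rightarrow> ('f::field, 'g) free_alg" where
  "gen g = Poly_Mapping.single (FM [g]) 1"

definition scal :: "'f::field \<Rightarrow> ('f, 'g) free_alg \<Rightarrow> ('f, 'g) free_alg" (infixr "*\<^sub>s" 75) where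
  "c *\<^sub>s p = Poly_Mapping.map (\<lambda>x. c * x) p"

definition free_algebra :: "('f::field, ('f, 'g) free_alg) module" where
  "free_algebra =
     \<lparr>carrier = UNIV, mult = (*), one = 1, zero = 0, add = (+), smult = scal\<rparr>"

lemma ring_free_algebra: "ring (free_algebra :: ('f::field, ('f, 'g) free_alg) module)"
proof (intro ringI abelian_groupI monoidI)
  fix x :: "('f, 'g) free_alg"
  show "\<exists>y \<in> carrier free_algebra. y \<oplus>\<^bsub>free_algebra\<^esub> x = \<zero>\<^bsub>free_algebra\<^esub>"
    by (rule bexI[of _ "- x"]) (simp_all add: free_algebra_def)
qed (simp_all add: free_algebra_def algebra_simps)

definition quotient_algebra :: "('f, 'a) module \<Rightarrow> 'a set \<Rightarrow> ('f, 'a set) module" where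
  "quotient_algebra M I =
     ring.extend (M Quot I)
       (module.fields (\<lambda>c C. \<Union>x \<in> C. I +>\<^bsub>M\<^esub> (c \<odot>\<^bsub>M\<^esub> x)))"

text \<open>A pair \<open>(l, r)\<close> in \<open>rels\<close> stands for the defining relation \<open>l = r\<close>.\<close>

definition relation_ideal ::
    "(('f::field, 'g) free_alg \<times> ('f, 'g) free_alg) set \<Rightarrow> ('f, 'g) free_alg set" where
  "relation_ideal rels = genideal free_algebra {l - r | l r. (l, r) \<in> rels}"

definition presented_algebra ::
    "(('f::field, 'g) free_alg \<times> ('f, 'g) free_alg) set
      \<Rightarrow> ('f, ('f, 'g) free_alg set) module" where
  "presented_algebra rels = quotient_algebra free_algebra (relation_ideal rels)"

definition presented_gen ::
    "(('f::field, 'g) free_alg \<times> ('f, 'g) free_alg) set \<Rightarrow> 'g \<Rightarrow> ('f, 'g) free_alg set" where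
  "presented_gen rels g = relation_ideal rels +>\<^bsub>free_algebra\<^esub> gen g"

definition comm :: "('f::field, 'g) free_alg \<Rightarrow> ('f, 'g) free_alg \<Rightarrow> ('f, 'g) free_alg" where
  "comm x y = x * y - y * x"

definition qcomm ::
    "'f::field \<Rightarrow> ('f, 'g) free_alg \<Rightarrow> ('f, 'g) free_alg \<Rightarrow> ('f, 'g) free_alg" where
  "qcomm q x y = q *\<^sub>s (x * y) - inverse q *\<^sub>s (y * x)"


section \<open>The algebra $U^+_q$ and its alternating elements\<close>

datatype Uplus_gen = GenA | GenB

inductive_set Uplus_rels ::
    "'f::field \<Rightarrow> (('f, Uplus_gen) free_alg \<times> ('f, Uplus_gen) free_alg) set"
  for q :: 'f where
  "(comm (gen GenA)
      (qcomm (inverse q) (gen GenA) (qcomm q (gen GenA) (gen GenB))), 0) \<in> Uplus_rels q"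
| "(comm (gen GenB)
      (qcomm (inverse q) (gen GenB) (qcomm q (gen GenB) (gen GenA))), 0) \<in> Uplus_rels q"

definition Uplus :: "'f::field \<Rightarrow> ('f, ('f, Uplus_gen) free_alg set) module" where
  "Uplus q = presented_algebra (Uplus_rels q)"

lemma finsum_fundef_cong [fundef_cong]:
  fixes f g :: "'i \<Rightarrow> 'a"
  assumes "M = N" "S = T" "\<And>x. x \<in> T \<Longrightarrow> f x = g x"
  shows "finsum M f S = finsum N g T"
proof -
  have sub: "(R, z) \<in> foldSetD D (h \<circ> f') e"
    if "(R, z) \<in> foldSetD D (h \<circ> g') e" "\<forall>x \<in> R. f' x = g' x"
    for R z e and D :: "'a set" and h and f' g' :: "'i \<Rightarrow> 'a"
    using that
  proof (induction rule: foldSetD.induct)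
    case emptyI
    then show ?case by (simp add: foldSetD.emptyI)
  next
    case (insertI x A y)
    have "(insert x A, (h \<circ> f') x y) \<in> foldSetD D (h \<circ> f') e"
      by (rule foldSetD.insertI) (use insertI in auto)
    then show ?case using insertI.prems by (simp add: comp_def)
  qed
  have "(T, z) \<in> foldSetD D (h \<circ> f) e \<longleftrightarrow> (T, z) \<in> foldSetD D (h \<circ> g) e"
    for z e and D :: "'a set" and h
    using sub[of T z D h g e f] sub[of T z D h f e g] assms(3) by auto
  then show ?thesis
    unfolding assms(1,2) finsum_def finprod_def foldD_def by simp
qed

text \<open>
  \<open>altW i\<close> is $W_i$ for every integer \<open>i\<close> (so the families $W_{-k}$ and $W_{k+1}$ together
  are indexed by all integers), \<open>altG n\<close> is $G_n$ and \<open>altGt n\<close> is $\tilde G_n$, with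
  $G_0 = \tilde G_0 = 1$. The recursion is stated in an arbitrary algebra \<open>U\<close>
  with two distinguished elements \<open>a\<close>, \<open>b\<close>.
\<close>

context
  fixes U :: "('f::field, 'a) module" (structure) and q :: 'f and a b :: 'a
begin

function altW :: "int \<Rightarrow> 'a" and altG :: "nat \<Rightarrow> 'a" and altGt :: "nat \<Rightarrow> 'a" where
  "altW i =
     (if i = 0 then a
      else if i = 1 then b
      else if i < 0 then
        (let n = nat (- i) in
          inverse (q - inverse q) \<odot>
            ((q \<odot> (altW 0 \<otimes> altG n)) \<ominus> (inverse q \<odot> (altG n \<otimes> altW 0))))
      else
        (let n = nat (i - 1) in
          inverse (q - inverse q) \<odot>
            ((q \<odot> (altG n \<otimes> altW 1)) \<ominus> (inverse q \<odot> (altW 1 \<otimes> altG n)))))"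
| "altG n =
     (if n = 0 then \<one>
      else
        (inverse (q ^ n + inverse q ^ n) \<odot>
          ((q \<odot> (\<Oplus>k \<in> {0..<n}.
                (q powi (int n - 1 - 2 * int k)) \<odot> (altW (- int k) \<otimes> altW (int n - int k))))
           \<ominus> (\<Oplus>k \<in> {1..<n}.
                (q powi (int n - 2 * int k)) \<odot> (altG k \<otimes> altGt (n - k)))))
        \<oplus> (inverse ((1 + inverse q ^ (2 * n)) * (1 - inverse q ^ 2)) \<odot>
            ((altW (int n) \<otimes> altW 0) \<ominus> (altW 0 \<otimes> altW (int n)))))"
| "altGt n =
     (if n = 0 then \<one>
      else
        altG n
        \<oplus> (inverse (1 - inverse q ^ 2) \<odot>
            ((altW 0 \<otimes> altW (int n)) \<ominus> (altW (int n) \<otimes> altW 0))))"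
  by pat_completeness auto

termination
  by (relation "Wellfounded.measure (\<lambda>x. case x of
        Inl i \<Rightarrow> (if i \<le> 0 then 3 * nat (- i) + 2 else 3 * nat (i - 1) + 2)
      | Inr (Inl n) \<Rightarrow> 3 * n
      | Inr (Inr n) \<Rightarrow> 3 * n + 1)") auto

declare altW.simps [simp del] altG.simps [simp del] altGt.simps [simp del]

end

definition Uplus_W :: "'f::field \<Rightarrow> int \<Rightarrow> ('f, Uplus_gen) free_alg set" where
  "Uplus_W q = altW (Uplus q) q
     (presented_gen (Uplus_rels q) GenA) (presented_gen (Uplus_rels q) GenB)"

definition Uplus_G :: "'f::field \<Rightarrow> nat \<Rightarrow> ('f, Uplus_gen) free_alg set" where
  "Uplus_G q = altG (Uplus q) q
     (presented_gen (Uplus_rels q) GenA) (presented_gen (Uplus_rels q) GenB)"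

definition Uplus_Gt :: "'f::field \<Rightarrow> nat \<Rightarrow> ('f, Uplus_gen) free_alg set" where
  "Uplus_Gt q = altGt (Uplus q) q
     (presented_gen (Uplus_rels q) GenA) (presented_gen (Uplus_rels q) GenB)"


section \<open>The algebra $\mathcal U^+_q$\<close>

text \<open>
  \<open>AltW i\<close> is the generator $\mathcal W_i$ for any integer \<open>i\<close>. Note the shift:
  \<open>AltG k\<close> and \<open>AltGt k\<close> are the generators $\mathcal G_{k+1}$ and $\tilde{\mathcal G}_{k+1}$.
\<close>

datatype alt_gen = AltW int | AltG nat | AltGt nat

abbreviation fW :: "int \<Rightarrow> ('f::field, alt_gen) free_alg" where
  "fW i \<equiv> gen (AltW i)"

abbreviation fG1 :: "nat \<Rightarrow> ('f::field, alt_gen) free_alg" where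
  "fG1 k \<equiv> gen (AltG k)"

abbreviation fGt1 :: "nat \<Rightarrow> ('f::field, alt_gen) free_alg" where
  "fGt1 k \<equiv> gen (AltGt k)"

inductive_set calU_rels ::
    "'f::field \<Rightarrow> (('f, alt_gen) free_alg \<times> ('f, alt_gen) free_alg) set"
  for q :: 'f where
  "(comm (fW 0) (fW (int k + 1)), (1 - inverse q ^ 2) *\<^sub>s (fGt1 k - fG1 k)) \<in> calU_rels q"
| "(comm (fW (- int k)) (fW 1), (1 - inverse q ^ 2) *\<^sub>s (fGt1 k - fG1 k)) \<in> calU_rels q"
| "(qcomm q (fW 0) (fG1 k), (q - inverse q) *\<^sub>s fW (- int k - 1)) \<in> calU_rels q"
| "(qcomm q (fGt1 k) (fW 0), (q - inverse q) *\<^sub>s fW (- int k - 1)) \<in> calU_rels q"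
| "(qcomm q (fG1 k) (fW 1), (q - inverse q) *\<^sub>s fW (int k + 2)) \<in> calU_rels q"
| "(qcomm q (fW 1) (fGt1 k), (q - inverse q) *\<^sub>s fW (int k + 2)) \<in> calU_rels q"
| "(comm (fW (- int k)) (fW (- int l)), 0) \<in> calU_rels q"
| "(comm (fW (int k + 1)) (fW (int l + 1)), 0) \<in> calU_rels q"
| "(comm (fW (- int k)) (fW (int l + 1)) + comm (fW (int k + 1)) (fW (- int l)), 0) \<in> calU_rels q"
| "(comm (fW (- int k)) (fG1 l) + comm (fG1 k) (fW (- int l)), 0) \<in> calU_rels q"
| "(comm (fW (- int k)) (fGt1 l) + comm (fGt1 k) (fW (- int l)), 0) \<in> calU_rels q"
| "(comm (fW (int k + 1)) (fG1 l) + comm (fG1 k) (fW (int l + 1)), 0) \<in> calU_rels q"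
| "(comm (fW (int k + 1)) (fGt1 l) + comm (fGt1 k) (fW (int l + 1)), 0) \<in> calU_rels q"
| "(comm (fG1 k) (fG1 l), 0) \<in> calU_rels q"
| "(comm (fGt1 k) (fGt1 l), 0) \<in> calU_rels q"
| "(comm (fGt1 k) (fG1 l) + comm (fG1 k) (fGt1 l), 0) \<in> calU_rels q"

definition calU :: "'f::field \<Rightarrow> ('f, ('f, alt_gen) free_alg set) module" where
  "calU q = presented_algebra (calU_rels q)"

definition calW :: "'f::field \<Rightarrow> int \<Rightarrow> ('f, alt_gen) free_alg set" where
  "calW q i = presented_gen (calU_rels q) (AltW i)"

definition calG :: "'f::field \<Rightarrow> nat \<Rightarrow> ('f, alt_gen) free_alg set" where
  "calG q n = (case n of 0 \<Rightarrow> \<one>\<^bsub>calU q\<^esub> | Suc k \<Rightarrow> presented_gen (calU_rels q) (AltG k))"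

definition calGt :: "'f::field \<Rightarrow> nat \<Rightarrow> ('f, alt_gen) free_alg set" where
  "calGt q n = (case n of 0 \<Rightarrow> \<one>\<^bsub>calU q\<^esub> | Suc k \<Rightarrow> presented_gen (calU_rels q) (AltGt k))"

end

theory Submission
  imports Defs
begin

text \<open>
  The $q$-Serre relations hold for $\mathcal W_0, \mathcal W_1$ already as a consequence of the
  relations of $\mathcal U^+_q$ with small indices, so there is a homomorphism
  $\phi : U^+_q \to \mathcal U^+_q$ with $W_0 \mapsto \mathcal W_0$, $W_1 \mapsto \mathcal W_1$,
  whose image is $\langle \mathcal W_0, \mathcal W_1\rangle$. The composite $\gamma \circ \phi$
  fixes the generators of $U^+_q$ and hence is the identity; this makes $\phi$ injective, and
  $\gamma$ inverts it on its image.
\<close>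

section \<open>Free algebras\<close>

text \<open>The exponent 0 is the empty word, so a scalar acts as left multiplication by a constant.
  Laws of scalars thereby become ring laws of the convolution product.\<close>

lemma scal_eq_mult: "c *\<^sub>s p = Poly_Mapping.single 0 c * p"
  by (simp add: scal_def mult_map_scale_conv_mult)

lemma scal_single [simp]:
  "c *\<^sub>s Poly_Mapping.single w d = Poly_Mapping.single w (c * d)"
  by (simp add: scal_eq_mult mult_single)

lemma scal_algebra_simps:
  fixes x y :: "('f::field, 'g) free_alg"
  shows scal_add: "c *\<^sub>s (x + y) = c *\<^sub>s x + c *\<^sub>s y"
    and scal_diff: "c *\<^sub>s (x - y) = c *\<^sub>s x - c *\<^sub>s y"
    and scal_scal: "c *\<^sub>s d *\<^sub>s x = (c * d) *\<^sub>s x"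
    and scal_zero: "c *\<^sub>s (0 :: ('f, 'g) free_alg) = 0"
    and scal_mult_left: "(c *\<^sub>s x) * y = c *\<^sub>s (x * y)"
  by (simp_all add: scal_eq_mult algebra_simps mult_single flip: mult.assoc)

lemma scal_add_left: "(c + d) *\<^sub>s x = c *\<^sub>s x + d *\<^sub>s x"
  by (simp add: scal_eq_mult single_add distrib_right)

lemma scal_diff_left: "(c - d) *\<^sub>s x = c *\<^sub>s x - d *\<^sub>s x"
  by (simp add: scal_eq_mult single_diff left_diff_distrib)

lemma scal_one [simp]: "1 *\<^sub>s x = x"
  by (simp add: scal_eq_mult)

section \<open>Induction over monomials, and over the operations of the free algebra\<close>

lemma poly_mapping_single_add_induct [case_names zero single_add]:
  assumes "P 0" and "\<And>w c p. P p \<Longrightarrow> P (Poly_Mapping.single w c + p)"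
  shows "P (p :: 'a \<Rightarrow>\<^sub>0 'b::comm_monoid_add)"
proof (induction p rule: update_induct)
  case const
  then show ?case by (rule assms(1))
next
  case (update p w c)
  \<comment> \<open>The induction only updates keys outside the support of \<open>p\<close>, so
    overwriting a coefficient there is the same as adding a monomial.\<close>
  have "Poly_Mapping.update w c p = Poly_Mapping.single w c + p"
    using update by (intro poly_mapping_eqI)
      (auto simp: lookup_update lookup_add lookup_single in_keys_iff)
  then show ?case using assms(2) update by simp
qed

text \<open>Here the constant has to pass \<open>x\<close> in a noncommutative ring. It commutes
  with each monomial, because 0 is neutral on both sides of a word and the coefficients commute;
  additivity does the rest.\<close>

lemma scal_mult_right: "x * (c *\<^sub>s y) = c *\<^sub>s (x * (y :: ('f::field, 'g) free_alg))"
proof -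
  have single: "Poly_Mapping.single w d * (c *\<^sub>s y) = c *\<^sub>s (Poly_Mapping.single w d * y)"
    for w :: "'g free_monoid" and d :: 'f
    by (simp add: scal_eq_mult mult_single mult.commute flip: mult.assoc)
  show ?thesis
    by (induction x rule: poly_mapping_single_add_induct)
      (simp_all add: scal_zero distrib_right scal_add single)
qed

text \<open>A word is a product of generators, a monomial is a scaled word, and every element is a
  finite sum of monomials.\<close>

lemma free_alg_induct [case_names one gen scal add mult]:
  fixes x :: "('f::field, 'g) free_alg"
  assumes one: "P 1" and gen: "\<And>g. P (gen g)"
    and scal: "\<And>c x. P x \<Longrightarrow> P (c *\<^sub>s x)"
    and add: "\<And>x y. P x \<Longrightarrow> P y \<Longrightarrow> P (x + y)"
    and mult: "\<And>x y. P x \<Longrightarrow> P y \<Longrightarrow> P (x * y)"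
  shows "P x"
proof -
  have word: "P (Poly_Mapping.single (FM ws) 1)" for ws
  proof (induction ws)
    case Nil
    then show ?case using one by (simp add: zero_free_monoid_def [symmetric])
  next
    case (Cons g ws)
    have "(Poly_Mapping.single (FM (g # ws)) 1 :: ('f, 'g) free_alg)
        = gen g * Poly_Mapping.single (FM ws) 1"
      by (simp add: gen_def mult_single)
    then show ?case using mult [OF gen Cons] by simp
  qed
  have single: "P (Poly_Mapping.single w c)" for w c
    using scal [OF word, of c] by (cases w) simp
  show ?thesis
  proof (induction x rule: poly_mapping_single_add_induct)
    case zero
    \<comment> \<open>Zero is reached as the monomial with coefficient 0.\<close>
    show ?case using single [of 0 0] by simp
  next
    case (single_add w c p)
    then show ?case using add single by blast
  qed
qed

section \<open>The universal property of the free algebra\<close>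

fun word_prod :: "('g \<Rightarrow> ('f::field, 'h) free_alg) \<Rightarrow> 'g free_monoid \<Rightarrow> ('f, 'h) free_alg" where
  "word_prod h (FM ws) = prod_list (map h ws)"

lemma word_prod_zero [simp]: "word_prod h 0 = 1"
  by (simp add: zero_free_monoid_def)

text \<open>The homomorphism that extends \<open>h\<close>. Its target is again a free algebra,
  because maps between presented algebras are built below on representatives.\<close>

definition free_lift ::
    "('g \<Rightarrow> ('f::field, 'h) free_alg) \<Rightarrow> ('f, 'g) free_alg \<Rightarrow> ('f, 'h) free_alg" where
  "free_lift h p = (\<Sum>w \<in> Poly_Mapping.keys p. Poly_Mapping.lookup p w *\<^sub>s word_prod h w)"

lemma free_lift_add: "free_lift h (x + y) = free_lift h x + free_lift h y"
  unfolding free_lift_def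
  by (rule setsum_keys_plus_distrib) (simp_all add: scal_eq_mult single_add distrib_right)

lemma free_lift_zero [simp]: "free_lift h 0 = 0"
  by (simp add: free_lift_def)

lemma free_lift_single: "free_lift h (Poly_Mapping.single w c) = c *\<^sub>s word_prod h w"
  by (simp add: free_lift_def scal_eq_mult)

lemma free_lift_one [simp]: "free_lift h 1 = 1"
  using free_lift_single [of h 0 1] by simp

lemma free_lift_gen [simp]: "free_lift h (gen g) = h g"
  by (simp add: gen_def free_lift_single)

text \<open>Both sides are additive in each factor, so monomials suffice; there
  \<open>word_prod\<close> turns concatenation of words into a product.\<close>

lemma free_lift_mult: "free_lift h (x * y) = free_lift h x * free_lift h y"
proof -
  have word: "word_prod h (v + w) = word_prod h v * word_prod h w" for v w
    by (cases v; cases w) simp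
  have single: "free_lift h (Poly_Mapping.single w c * y) = c *\<^sub>s word_prod h w * free_lift h y"
    for w c
    by (induction y rule: poly_mapping_single_add_induct)
      (simp_all add: distrib_left free_lift_add mult_single free_lift_single word
        scal_mult_left scal_mult_right scal_scal scal_add mult.commute [of c])
  show ?thesis
    by (induction x rule: poly_mapping_single_add_induct)
      (simp_all add: distrib_right free_lift_add free_lift_single single scal_mult_left)
qed

lemma free_lift_scal: "free_lift h (c *\<^sub>s x) = c *\<^sub>s free_lift h x"
  unfolding scal_eq_mult free_lift_mult
  by (simp add: free_lift_single scal_eq_mult)

lemma free_lift_diff: "free_lift h (x - y) = free_lift h x - free_lift h y"
  by (metis add_diff_cancel_right' diff_add_cancel free_lift_add)

lemma free_lift_comm: "free_lift h (comm x y) = comm (free_lift h x) (free_lift h y)"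
  by (simp add: comm_def free_lift_diff free_lift_mult)

lemma free_lift_qcomm: "free_lift h (qcomm q x y) = qcomm q (free_lift h x) (free_lift h y)"
  by (simp add: qcomm_def free_lift_diff free_lift_mult free_lift_scal)


section \<open>Presented algebras\<close>

lemma free_algebra_simps [simp]:
  "carrier free_algebra = UNIV" "x \<otimes>\<^bsub>free_algebra\<^esub> y = x * y" "\<one>\<^bsub>free_algebra\<^esub> = 1"
  "\<zero>\<^bsub>free_algebra\<^esub> = 0" "x \<oplus>\<^bsub>free_algebra\<^esub> y = x + y" "c \<odot>\<^bsub>free_algebra\<^esub> x = c *\<^sub>s x"
  by (simp_all add: free_algebra_def)

lemma free_algebra_minus [simp]:
  fixes x :: "('f::field, 'g) free_alg"
  shows "\<ominus>\<^bsub>free_algebra\<^esub> x = - x"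
proof -
  interpret ring "free_algebra :: ('f::field, ('f, 'g) free_alg) module"
    by (rule ring_free_algebra)
  show ?thesis
    by (rule minus_equality) simp_all
qed

section \<open>Closure properties of the relation ideal\<close>

lemma ideal_relation_ideal: "ideal (relation_ideal rels) free_algebra"
  unfolding relation_ideal_def by (rule ring.genideal_ideal [OF ring_free_algebra]) simp

lemma relation_ideal_rel: "(l, r) \<in> rels \<Longrightarrow> l - r \<in> relation_ideal rels"
  unfolding relation_ideal_def
  by (rule subsetD [OF ring.genideal_self [OF ring_free_algebra]]) auto

lemma relation_ideal_closed:
  shows relation_ideal_zero: "0 \<in> relation_ideal rels"
    and relation_ideal_add:
      "x \<in> relation_ideal rels \<Longrightarrow> y \<in> relation_ideal rels \<Longrightarrow> x + y \<in> relation_ideal rels"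
    and relation_ideal_minus: "x \<in> relation_ideal rels \<Longrightarrow> - x \<in> relation_ideal rels"
    and relation_ideal_mult_left: "x \<in> relation_ideal rels \<Longrightarrow> y * x \<in> relation_ideal rels"
    and relation_ideal_mult_right: "x \<in> relation_ideal rels \<Longrightarrow> x * y \<in> relation_ideal rels"
proof -
  interpret ideal "relation_ideal rels" free_algebra by (rule ideal_relation_ideal)
  show "0 \<in> relation_ideal rels"
    using additive_subgroup.zero_closed [OF is_additive_subgroup] by simp
  show "x + y \<in> relation_ideal rels" if "x \<in> relation_ideal rels" "y \<in> relation_ideal rels"
    using additive_subgroup.a_closed [OF is_additive_subgroup that] by simp
  show "- x \<in> relation_ideal rels" if "x \<in> relation_ideal rels"
    using additive_subgroup.a_inv_closed [OF is_additive_subgroup that] by simp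
  show "y * x \<in> relation_ideal rels" if "x \<in> relation_ideal rels"
    using I_l_closed [OF that] by simp
  show "x * y \<in> relation_ideal rels" if "x \<in> relation_ideal rels"
    using I_r_closed [OF that] by simp
qed

lemma relation_ideal_diff:
  "x \<in> relation_ideal rels \<Longrightarrow> y \<in> relation_ideal rels \<Longrightarrow> x - y \<in> relation_ideal rels"
  using relation_ideal_add [OF _ relation_ideal_minus] by force

lemma relation_ideal_scal: "x \<in> relation_ideal rels \<Longrightarrow> c *\<^sub>s x \<in> relation_ideal rels"
  unfolding scal_eq_mult by (rule relation_ideal_mult_left)

lemma relation_ideal_qcomm: "x \<in> relation_ideal rels \<Longrightarrow> qcomm q a x \<in> relation_ideal rels"
  unfolding qcomm_def
  by (intro relation_ideal_diff relation_ideal_scal relation_ideal_mult_left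
      relation_ideal_mult_right)

section \<open>Computing in a presented algebra with representatives\<close>

definition presented_class ::
    "(('f::field, 'g) free_alg \<times> ('f, 'g) free_alg) set \<Rightarrow> ('f, 'g) free_alg
      \<Rightarrow> ('f, 'g) free_alg set" where
  "presented_class rels x = relation_ideal rels +>\<^bsub>free_algebra\<^esub> x"

lemma presented_gen_eq: "presented_gen rels g = presented_class rels (gen g)"
  by (simp add: presented_gen_def presented_class_def)

lemma mem_presented_class: "y \<in> presented_class rels x \<longleftrightarrow> y - x \<in> relation_ideal rels"
  by (auto simp: presented_class_def a_r_coset_def' intro: bexI [of _ "y - x"])

lemma presented_class_self: "x \<in> presented_class rels x"
  by (simp add: mem_presented_class relation_ideal_zero)

lemma presented_class_eq_iff:
  "presented_class rels x = presented_class rels y \<longleftrightarrow> x - y \<in> relation_ideal rels"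
proof
  assume "presented_class rels x = presented_class rels y"
  then show "x - y \<in> relation_ideal rels"
    using presented_class_self mem_presented_class by blast
next
  assume xy: "x - y \<in> relation_ideal rels"
  have "z - x \<in> relation_ideal rels \<longleftrightarrow> z - y \<in> relation_ideal rels" for z
    using relation_ideal_add [OF _ xy, of "z - x"] relation_ideal_diff [OF _ xy, of "z - y"]
    by (auto simp: algebra_simps)
  then show "presented_class rels x = presented_class rels y"
    by (auto simp: mem_presented_class)
qed

lemma presented_algebra_simps:
  shows carrier_presented: "carrier (presented_algebra rels) = range (presented_class rels)"
    and mult_presented: "presented_class rels x \<otimes>\<^bsub>presented_algebra rels\<^esub> presented_class rels y
      = presented_class rels (x * y)"
    and add_presented: "presented_class rels x \<oplus>\<^bsub>presented_algebra rels\<^esub> presented_class rels y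
      = presented_class rels (x + y)"
    and one_presented: "\<one>\<^bsub>presented_algebra rels\<^esub> = presented_class rels 1"
    and zero_presented: "\<zero>\<^bsub>presented_algebra rels\<^esub> = presented_class rels 0"
    and smult_presented: "c \<odot>\<^bsub>presented_algebra rels\<^esub> presented_class rels x
      = presented_class rels (c *\<^sub>s x)"
proof -
  interpret ideal "relation_ideal rels" free_algebra by (rule ideal_relation_ideal)
  note defs = presented_algebra_def quotient_algebra_def FactRing_def ring.defs module.defs
  show "carrier (presented_algebra rels) = range (presented_class rels)"
    by (auto simp: defs A_RCOSETS_def' presented_class_def a_r_coset_def')
  show "presented_class rels x \<otimes>\<^bsub>presented_algebra rels\<^esub> presented_class rels y
      = presented_class rels (x * y)"
    using rcoset_mult_add [of x y] by (simp add: defs presented_class_def)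
  show "presented_class rels x \<oplus>\<^bsub>presented_algebra rels\<^esub> presented_class rels y
      = presented_class rels (x + y)"
    using a_rcos_sum [of x y] by (simp add: defs presented_class_def)
  show "\<one>\<^bsub>presented_algebra rels\<^esub> = presented_class rels 1"
    by (simp add: defs presented_class_def)
  show "\<zero>\<^bsub>presented_algebra rels\<^esub> = presented_class rels 0"
    by (auto simp: defs mem_presented_class)
  \<comment> \<open>The scalar multiple in the quotient is a union over all representatives of the
    coset. Each representative contributes the same coset and there is at least one, so the union
    collapses.\<close>
  have "presented_class rels (c *\<^sub>s y) = presented_class rels (c *\<^sub>s x)"
    if "y \<in> presented_class rels x" for y
    using that
    by (simp add: presented_class_eq_iff mem_presented_class scal_diff [symmetric]
        relation_ideal_scal)
  then have "(\<Union>y \<in> presented_class rels x. presented_class rels (c *\<^sub>s y))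
      = presented_class rels (c *\<^sub>s x)"
    using presented_class_self by blast
  then show "c \<odot>\<^bsub>presented_algebra rels\<^esub> presented_class rels x = presented_class rels (c *\<^sub>s x)"
    by (simp add: defs presented_class_def)
qed

lemma ring_presented_algebra: "ring (presented_algebra rels)"
proof (intro ringI abelian_groupI monoidI)
  fix x assume "x \<in> carrier (presented_algebra rels)"
  then obtain x' where "x = presented_class rels x'"
    by (auto simp: carrier_presented)
  then show "\<exists>y \<in> carrier (presented_algebra rels).
      y \<oplus>\<^bsub>presented_algebra rels\<^esub> x = \<zero>\<^bsub>presented_algebra rels\<^esub>"
    by (intro bexI [of _ "presented_class rels (- x')"]) (simp_all add: presented_algebra_simps)
qed (auto simp: presented_algebra_simps algebra_simps)

text \<open>\<open>free_alg_induct\<close> carried over to cosets. It serves twice: for the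
  uniqueness of homomorphisms with given values on generators, and for the minimality of their image
  among subalgebras.\<close>

lemma carrier_presented_induct [consumes 1, case_names one gen scal add mult]:
  assumes "x \<in> carrier (presented_algebra rels)"
    and "P \<one>\<^bsub>presented_algebra rels\<^esub>" and "\<And>g. P (presented_gen rels g)"
    and "\<And>c x. x \<in> carrier (presented_algebra rels) \<Longrightarrow> P x \<Longrightarrow> P (c \<odot>\<^bsub>presented_algebra rels\<^esub> x)"
    and "\<And>x y. x \<in> carrier (presented_algebra rels) \<Longrightarrow> y \<in> carrier (presented_algebra rels)
      \<Longrightarrow> P x \<Longrightarrow> P y \<Longrightarrow> P (x \<oplus>\<^bsub>presented_algebra rels\<^esub> y)"
    and "\<And>x y. x \<in> carrier (presented_algebra rels) \<Longrightarrow> y \<in> carrier (presented_algebra rels)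
      \<Longrightarrow> P x \<Longrightarrow> P y \<Longrightarrow> P (x \<otimes>\<^bsub>presented_algebra rels\<^esub> y)"
  shows "P x"
proof -
  have "P (presented_class rels p)" for p
    using assms(2-)
    by (induction p rule: free_alg_induct)
      (auto simp: presented_gen_eq carrier_presented one_presented
        smult_presented [symmetric] add_presented [symmetric] mult_presented [symmetric])
  then show ?thesis using assms(1) by (auto simp: carrier_presented)
qed

section \<open>Homomorphisms out of a presented algebra\<close>

lemma alg_homD:
  assumes "h \<in> alg_hom M N"
  shows "x \<in> carrier M \<Longrightarrow> h x \<in> carrier N"
    and "h \<one>\<^bsub>M\<^esub> = \<one>\<^bsub>N\<^esub>"
    and "x \<in> carrier M \<Longrightarrow> h (c \<odot>\<^bsub>M\<^esub> x) = c \<odot>\<^bsub>N\<^esub> h x"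
    and "x \<in> carrier M \<Longrightarrow> y \<in> carrier M \<Longrightarrow> h (x \<oplus>\<^bsub>M\<^esub> y) = h x \<oplus>\<^bsub>N\<^esub> h y"
    and "x \<in> carrier M \<Longrightarrow> y \<in> carrier M \<Longrightarrow> h (x \<otimes>\<^bsub>M\<^esub> y) = h x \<otimes>\<^bsub>N\<^esub> h y"
  using assms by (auto simp: alg_hom_def ring_hom_def)

lemma alg_hom_presented_eqI:
  assumes f: "f \<in> alg_hom (presented_algebra rels) N"
    and h: "h \<in> alg_hom (presented_algebra rels) N"
    and "\<And>g. f (presented_gen rels g) = h (presented_gen rels g)"
    and "x \<in> carrier (presented_algebra rels)"
  shows "f x = h x"
  using assms(4)
  by (induction rule: carrier_presented_induct)
    (simp_all add: alg_homD [OF f] alg_homD [OF h] assms(3))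

lemma alg_hom_id: "(\<lambda>x. x) \<in> alg_hom M M"
  by (simp add: alg_hom_def ring_hom_def)

lemma alg_hom_comp:
  "f \<in> alg_hom M N \<Longrightarrow> h \<in> alg_hom N K \<Longrightarrow> (\<lambda>x. h (f x)) \<in> alg_hom M K"
  by (simp add: alg_hom_def ring_hom_def Pi_iff)

text \<open>The preimage of an ideal under a homomorphism is an ideal. It contains the differences
  \<open>l - r\<close>, hence the whole ideal that they generate.\<close>

lemma relation_ideal_free_lift:
  fixes h :: "'g \<Rightarrow> ('f::field, 'h) free_alg"
  assumes "\<And>l r. (l, r) \<in> rels \<Longrightarrow> free_lift h (l - r) \<in> relation_ideal rels'"
    and "x \<in> relation_ideal rels"
  shows "free_lift h x \<in> relation_ideal rels'"
proof -
  interpret F: ring "free_algebra :: ('f, ('f, 'g) free_alg) module" by (rule ring_free_algebra)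
  let ?J = "{x. free_lift h x \<in> relation_ideal rels'}"
  have minus: "free_lift h (- x) = - free_lift h x" for x
    using free_lift_diff [of h 0 x] by simp
  have "ideal ?J free_algebra"
  proof (intro idealI ring_free_algebra)
    show "subgroup ?J (add_monoid free_algebra)"
      by (rule F.add.subgroupI)
        (auto simp: free_lift_add minus relation_ideal_closed a_inv_def [symmetric]
          intro: exI [of _ 0])
  qed (auto simp: free_lift_mult relation_ideal_closed)
  then have "relation_ideal rels \<subseteq> ?J"
    unfolding relation_ideal_def [of rels] by (rule F.genideal_minimal) (use assms(1) in auto)
  then show ?thesis using assms(2) by blast
qed

text \<open>Von Dyck's principle: an assignment on generators that respects the defining relations
  induces a homomorphism.\<close>

lemma presented_algebra_lift:
  assumes "\<And>l r. (l, r) \<in> rels \<Longrightarrow> free_lift h (l - r) \<in> relation_ideal rels'"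
  shows "\<exists>f \<in> alg_hom (presented_algebra rels) (presented_algebra rels').
    \<forall>g. f (presented_gen rels g) = presented_class rels' (h g)"
proof -
  define f where "f C = presented_class rels' (free_lift h (SOME x. x \<in> C))" for C
  \<comment> \<open>The chosen representative does not matter: it differs from \<open>x\<close> by
    an element of the relation ideal, which \<open>free_lift h\<close> sends into the relation ideal
    of the target.\<close>
  have f: "f (presented_class rels x) = presented_class rels' (free_lift h x)" for x
  proof -
    have "(SOME y. y \<in> presented_class rels x) \<in> presented_class rels x"
      by (rule someI) (rule presented_class_self)
    then show ?thesis
      unfolding f_def presented_class_eq_iff free_lift_diff [symmetric]
      by (intro relation_ideal_free_lift [OF assms]) (simp_all add: mem_presented_class)
  qed
  show ?thesis
  proof (intro bexI allI)
    show "f \<in> alg_hom (presented_algebra rels) (presented_algebra rels')"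
      by (auto simp: alg_hom_def ring_hom_def presented_algebra_simps f free_lift_add
          free_lift_mult free_lift_scal)
    show "f (presented_gen rels g) = presented_class rels' (h g)" for g
      by (simp add: presented_gen_eq f)
  qed
qed

text \<open>The image is a subalgebra containing the images of the generators. Conversely, induction
  over the source puts every \<open>f x\<close> into any subalgebra \<open>T\<close> that contains
  those images.\<close>

lemma image_alg_hom_presented:
  assumes f: "f \<in> alg_hom (presented_algebra rels) M" and M: "ring M"
  shows "f ` carrier (presented_algebra rels)
    = carrier (generated_subalgebra M (range (\<lambda>g. f (presented_gen rels g))))"
    (is "?I = _")
proof -
  interpret P: ring "presented_algebra rels" by (rule ring_presented_algebra)
  interpret M: ring M by (rule M)
  interpret ring_hom_ring "presented_algebra rels" M f
    by (rule ring_hom_ringI2) (use f in \<open>simp_all add: alg_hom_def P.ring_axioms M\<close>)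
  have smult_closed: "c \<odot>\<^bsub>presented_algebra rels\<^esub> x \<in> carrier (presented_algebra rels)"
    if "x \<in> carrier (presented_algebra rels)" for c x
    using that by (auto simp: carrier_presented smult_presented)
  have "is_subalgebra ?I M"
    unfolding is_subalgebra_def
    using img_is_subring [OF P.carrier_is_subring] alg_homD(3) [OF f, symmetric] smult_closed
    by auto
  moreover have "range (\<lambda>g. f (presented_gen rels g)) \<subseteq> ?I"
    by (auto simp: presented_gen_eq carrier_presented)
  moreover have "f x \<in> T"
    if T: "is_subalgebra T M" "range (\<lambda>g. f (presented_gen rels g)) \<subseteq> T"
      and x: "x \<in> carrier (presented_algebra rels)" for T x
    using x
  proof (induction rule: carrier_presented_induct)
  qed (use T in \<open>auto simp: is_subalgebra_def alg_homD [OF f] intro: subringE\<close>)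
  ultimately show ?thesis
    by (auto simp: generated_subalgebra_def)
qed


section \<open>The $q$-Serre relations in $\mathcal U^+_q$\<close>

text \<open>
  Left and right multiplication by \<open>a\<close> commute, so the three brackets of the $q$-Serre expression
  may be reordered with \<open>comm a\<close> innermost. Replacing \<open>comm a b\<close> by \<open>c (t - g)\<close> and then using
  both expressions for \<open>w\<close> leaves a multiple of \<open>comm a w\<close>.
\<close>
lemma q_Serre_mem:
  fixes a b g t w :: "('f::field, 'g) free_alg"
  assumes "comm a b - c *\<^sub>s (t - g) \<in> relation_ideal rels"
    and "qcomm q a g - s *\<^sub>s w \<in> relation_ideal rels"
    and "qcomm q t a - s *\<^sub>s w \<in> relation_ideal rels"
    and "comm a w \<in> relation_ideal rels"
  shows "comm a (qcomm (inverse q) a (qcomm q a b)) \<in> relation_ideal rels"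
proof -
  note expand = comm_def qcomm_def algebra_simps scal_algebra_simps scal_mult_right
    scal_add_left scal_diff_left
  have "comm a (qcomm (inverse q) a (qcomm q a b))
      = qcomm q a (qcomm (inverse q) a (comm a b - c *\<^sub>s (t - g)))
        - c *\<^sub>s qcomm q a (qcomm q t a - s *\<^sub>s w)
        - c *\<^sub>s qcomm (inverse q) a (qcomm q a g - s *\<^sub>s w)
        - (c * s * (q + inverse q)) *\<^sub>s comm a w"
    by (simp add: expand)
  then show ?thesis
    by (simp only:) (intro relation_ideal_diff relation_ideal_scal relation_ideal_qcomm assms)
qed

text \<open>Two instances of \<open>q_Serre_mem\<close> with relations of lowest index:
  \<open>w\<close> is \<open>fW (- 1)\<close> for the first and \<open>fW 2\<close> for the
  second.\<close>

lemma calU_q_Serre: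
  fixes q :: "'f::field"
  shows "comm (fW 0) (qcomm (inverse q) (fW 0) (qcomm q (fW 0) (fW 1)))
      \<in> relation_ideal (calU_rels q)" (is ?A)
    and "comm (fW 1) (qcomm (inverse q) (fW 1) (qcomm q (fW 1) (fW 0)))
      \<in> relation_ideal (calU_rels q)" (is ?B)
proof -
  note rels = calU_rels.intros [where q = q, THEN relation_ideal_rel]
  show ?A
    by (rule q_Serre_mem) (use rels(1) [of 0] rels(3) [of 0] rels(4) [of 0]
        rels(7) [of 0 1] in simp_all)
  \<comment> \<open>Reversing the commutator changes the sign, so for the second relation
    \<open>fG1 0\<close> and \<open>fGt1 0\<close> exchange their roles as \<open>g\<close> and
    \<open>t\<close>.\<close>
  have "comm (fW 1) (fW 0) - (1 - inverse q ^ 2) *\<^sub>s (fG1 0 - fGt1 0) \<in> relation_ideal (calU_rels q)"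
    using relation_ideal_minus [OF rels(1) [of 0]]
    by (simp add: comm_def scal_diff algebra_simps)
  then show ?B
    by (rule q_Serre_mem) (use rels(6) [of 0] rels(5) [of 0] rels(8) [of 0 1] in simp_all)
qed

section \<open>The embedding of $U^+_q$ and its inverse\<close>

theorem proposition6p4:
  fixes q :: "'f::field"
    and \<gamma> :: "('f, alt_gen) free_alg set \<Rightarrow> ('f, Uplus_gen) free_alg set"
  assumes "q \<noteq> 0"
    and "\<forall>n::nat. n > 0 \<longrightarrow> q ^ n \<noteq> 1"
    and "\<gamma> \<in> alg_hom (calU q) (Uplus q)"
    and "\<forall>n::nat. \<gamma> (calW q (- int n)) = Uplus_W q (- int n)"
    and "\<forall>n::nat. \<gamma> (calW q (int n + 1)) = Uplus_W q (int n + 1)"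
    and "\<forall>n::nat. \<gamma> (calG q n) = Uplus_G q n"
    and "\<forall>n::nat. \<gamma> (calGt q n) = Uplus_Gt q n"
  defines "S \<equiv> generated_subalgebra (calU q) {calW q 0, calW q 1}"
  shows "(\<exists>\<phi>. \<phi> \<in> alg_iso (Uplus q) S \<and>
              \<phi> (Uplus_W q 0) = calW q 0 \<and> \<phi> (Uplus_W q 1) = calW q 1) \<and>
         (\<forall>\<phi>. \<phi> \<in> alg_iso (Uplus q) S \<and>
              \<phi> (Uplus_W q 0) = calW q 0 \<and> \<phi> (Uplus_W q 1) = calW q 1 \<longrightarrow>
              (\<forall>y \<in> carrier S. inv_into (carrier (Uplus q)) \<phi> y = \<gamma> y))"
proof -
  have W: "Uplus_W q 0 = presented_gen (Uplus_rels q) GenA"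
    "Uplus_W q 1 = presented_gen (Uplus_rels q) GenB"
    by (simp_all add: Uplus_W_def altW.simps)
  have \<gamma>: "\<gamma> (calW q 0) = Uplus_W q 0" "\<gamma> (calW q 1) = Uplus_W q 1"
    using assms(4) [rule_format, of 0] assms(5) [rule_format, of 0] by simp_all
  \<comment> \<open>Stated for every homomorphism with the prescribed values, since the claim about
    the inverse concerns all such isomorphisms and not only the one constructed. The composite
    agrees with the identity on both generators, hence everywhere.\<close>
  have \<gamma>\<phi>: "\<gamma> (\<phi> x) = x"
    if "\<phi> \<in> alg_hom (Uplus q) (calU q)" "\<phi> (Uplus_W q 0) = calW q 0" "\<phi> (Uplus_W q 1) = calW q 1"
      and "x \<in> carrier (Uplus q)" for \<phi> x
  proof (rule alg_hom_presented_eqI [of "\<lambda>x. \<gamma> (\<phi> x)" "Uplus_rels q" "Uplus q" "\<lambda>x. x"])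
    show "(\<lambda>x. \<gamma> (\<phi> x)) \<in> alg_hom (presented_algebra (Uplus_rels q)) (Uplus q)"
      using alg_hom_comp [OF that(1) assms(3)] by (simp add: Uplus_def)
    show "\<gamma> (\<phi> (presented_gen (Uplus_rels q) g)) = presented_gen (Uplus_rels q) g" for g
      using that(2,3) \<gamma> W by (cases g) simp_all
  qed (use alg_hom_id that(4) in \<open>simp_all add: Uplus_def\<close>)
  \<comment> \<open>\<open>S\<close> differs from \<open>calU q\<close> only in its carrier, so a
    homomorphism into \<open>S\<close> is one into \<open>calU q\<close> whose values stay in
    \<open>carrier S\<close>.\<close>
  have S_hom: "alg_hom M S = {h \<in> alg_hom M (calU q). h ` carrier M \<subseteq> carrier S}"
    if "carrier S \<subseteq> carrier (calU q)" for M :: "('f, 'c) module"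
    using that by (auto simp: S_def generated_subalgebra_def alg_hom_def ring_hom_def)
  define h :: "Uplus_gen \<Rightarrow> ('f, alt_gen) free_alg"
    where "h g = (case g of GenA \<Rightarrow> fW 0 | GenB \<Rightarrow> fW 1)" for g
  \<comment> \<open>The two defining relations of \<open>Uplus q\<close> go to the $q$-Serre
    expressions treated in \<open>calU_q_Serre\<close>.\<close>
  have "free_lift h (l - r) \<in> relation_ideal (calU_rels q)" if "(l, r) \<in> Uplus_rels q" for l r
    using that by cases (simp_all add: free_lift_comm free_lift_qcomm h_def calU_q_Serre)
  from presented_algebra_lift [OF this] obtain \<phi>
    where "\<phi> \<in> alg_hom (presented_algebra (Uplus_rels q)) (presented_algebra (calU_rels q))"
    and \<phi>_gen: "\<And>g. \<phi> (presented_gen (Uplus_rels q) g) = presented_class (calU_rels q) (h g)"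
    by blast
  then have \<phi>: "\<phi> \<in> alg_hom (Uplus q) (calU q)"
    by (simp add: Uplus_def calU_def)
  have \<phi>W: "\<phi> (Uplus_W q 0) = calW q 0" "\<phi> (Uplus_W q 1) = calW q 1"
    unfolding W \<phi>_gen by (simp_all add: h_def calW_def presented_gen_eq)
  have "range (\<lambda>g. \<phi> (presented_gen (Uplus_rels q) g)) = {calW q 0, calW q 1}"
    using \<phi>W W by (auto simp: image_iff) (metis Uplus_gen.exhaust)+
  then have img: "\<phi> ` carrier (Uplus q) = carrier S"
    using image_alg_hom_presented [of \<phi> "Uplus_rels q" "calU q"] \<phi>
      ring_presented_algebra [of "calU_rels q"]
    by (simp add: S_def Uplus_def calU_def)
  have S_sub: "carrier S \<subseteq> carrier (calU q)"
    using alg_homD(1) [OF \<phi>] unfolding img [symmetric] by blast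
  \<comment> \<open>By \<open>\<gamma>\<phi>\<close>, the map \<open>\<gamma>\<close> is a left
    inverse.\<close>
  have "inj_on \<phi> (carrier (Uplus q))"
    by (rule inj_on_inverseI) (rule \<gamma>\<phi> [OF \<phi> \<phi>W])
  then have "\<phi> \<in> alg_iso (Uplus q) S"
    using \<phi> img by (simp add: alg_iso_def S_hom [OF S_sub] bij_betw_def)
  moreover have "inv_into (carrier (Uplus q)) \<psi> y = \<gamma> y"
    if \<psi>: "\<psi> \<in> alg_iso (Uplus q) S" "\<psi> (Uplus_W q 0) = calW q 0" "\<psi> (Uplus_W q 1) = calW q 1"
      and y: "y \<in> carrier S" for \<psi> y
  proof -
    \<comment> \<open>Write \<open>y\<close> as \<open>\<psi> x\<close> with \<open>x\<close> in the
      carrier of \<open>Uplus q\<close>; applying \<open>\<gamma>\<close> to both sides gives back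
      \<open>x\<close>.\<close>
    have "inv_into (carrier (Uplus q)) \<psi> y \<in> carrier (Uplus q)"
      "\<psi> (inv_into (carrier (Uplus q)) \<psi> y) = y"
      using \<psi>(1) y by (auto simp: alg_iso_def bij_betw_def inv_into_into f_inv_into_f)
    then show ?thesis
      using \<gamma>\<phi> [OF _ \<psi>(2,3)] \<psi>(1) by (force simp: alg_iso_def S_hom [OF S_sub])
  qed
  ultimately show ?thesis
    using \<phi>W by blast
qed

end
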